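(* Let $\delta$ be an arbitrary real number, $k\in\mathbb{N}$, and let $k_1<k_2$ be arbitrary real numbers. For every $\varepsilon>0$ there exist $\beta\in\mathbb{Q}\setminus\mathbb{Z}$ and $\gamma\in\mathbb{Z}^\ast$ with $dom^+(\beta)=\emptyset=dom^-(\gamma)$ and $\max dom^-(\beta)<k_1<k_2<\min dom^+(\gamma)$, and integers $m(p,q)$ for integers $0\leq p,q\leq k$, such that $|\delta(p\beta+q\gamma)^2-m(p,q)|<\varepsilon$ for all integers $0\leq p,q\leq k$.
   Context: Notation: $\mathbb{N}=\{1,2,\ldots\}$, $\mathbb{Z}^\ast=\mathbb{Z}\setminus\{0\}$. Expansion of rationals: every rational number $q$ has a unique expression $q=\sum_{s=1}^{\infty}q_{-s}\frac{(-1)^{s}}{(s+1)!}+\sum_{r=1}^{\infty}q_{r}(-1)^{r+1}r!$ with integers $0\leq q_{-s}\leq s$ for $s\geq 1$ and $0\leq q_r\leq r$ for $r\geq 1$, all but finitely many of which are zero. Put $dom(q)=\{t\in\mathbb{Z}^\ast: q_t\neq 0\}$, $dom^-(q)=\{t\in dom(q): t<0\}$, $dom^+(q)=\{t\in dom(q): t>0\}$. *)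

theory Defs
  imports Complex_Main
begin

text \<open>
  The digit \<open>c t\<close> is the coefficient \<open>q\<^sub>t\<close>, for \<open>t \<noteq> 0\<close>; the index \<open>0\<close> does not occur in the
  expansion, and \<open>c 0 = 0\<close> is imposed so that \<open>c\<close> is determined as a function on all of \<open>int\<close>.
  Since almost all digits vanish, the two series are sums over the supports.
\<close>

definition is_expansion :: "rat \<Rightarrow> (int \<Rightarrow> int) \<Rightarrow> bool" where
  "is_expansion q c \<longleftrightarrow>
     c 0 = 0 \<and> finite {t. c t \<noteq> 0} \<and>
     (\<forall>s::nat. s \<ge> 1 \<longrightarrow> 0 \<le> c (- int s) \<and> c (- int s) \<le> int s) \<and>
     (\<forall>r::nat. r \<ge> 1 \<longrightarrow> 0 \<le> c (int r) \<and> c (int r) \<le> int r) \<and>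
     q = (\<Sum>s | s \<ge> 1 \<and> c (- int s) \<noteq> 0. of_int (c (- int s)) * ((-1) ^ s / fact (s + 1)))
       + (\<Sum>r | r \<ge> 1 \<and> c (int r) \<noteq> 0. of_int (c (int r)) * (-1) ^ (r + 1) * fact r)"

definition digit :: "rat \<Rightarrow> int \<Rightarrow> int" where
  "digit q = (THE c. is_expansion q c)"

definition rat_dom :: "rat \<Rightarrow> int set" where
  "rat_dom q = {t. t \<noteq> 0 \<and> digit q t \<noteq> 0}"

definition dom_neg :: "rat \<Rightarrow> int set" where
  "dom_neg q = {t \<in> rat_dom q. t < 0}"

definition dom_pos :: "rat \<Rightarrow> int set" where
  "dom_pos q = {t \<in> rat_dom q. t > 0}"

lemma expansion_sums:
  assumes "finite {t. c t \<noteq> 0}"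
  obtains K where "\<And>s. s > K \<Longrightarrow> c (- int s) = 0" "\<And>r. r > K \<Longrightarrow> c (int r) = 0"
proof -
  obtain B where B: "\<And>t. c t \<noteq> 0 \<Longrightarrow> \<bar>t\<bar> \<le> B"
    using finite_imageI[OF assms, of abs] finite_has_maximal
    by (metis (mono_tags, lifting) assms bdd_above.unfold bdd_above_finite image_eqI mem_Collect_eq)
  show ?thesis by (rule that[of "nat B"]) (use B in force)+
qed

lemma expansion_sums_eq:
  assumes "\<And>s. s > K \<Longrightarrow> c (- int s) = 0" "\<And>r. r > K \<Longrightarrow> c (int r) = 0"
  shows "(\<Sum>s | s \<ge> 1 \<and> c (- int s) \<noteq> 0. of_int (c (- int s)) * ((-1) ^ s / fact (s + 1)))
       = (\<Sum>s=1..K. of_int (c (- int s)) * ((-1) ^ s / fact (s + 1)) :: rat)"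
    and "(\<Sum>r | r \<ge> 1 \<and> c (int r) \<noteq> 0. of_int (c (int r)) * (-1) ^ (r + 1) * fact r)
       = (\<Sum>r=1..K. of_int (c (int r)) * (-1) ^ (r + 1) * fact r :: rat)"
proof -
  have "s \<le> K" if "c (- int s) \<noteq> 0" for s using that assms(1)[of s] by (cases "s > K") auto
  moreover have "r \<le> K" if "c (int r) \<noteq> 0" for r using that assms(2)[of r] by (cases "r > K") auto
  ultimately have "{s. s \<ge> 1 \<and> c (- int s) \<noteq> 0} \<subseteq> {1..K}" "{r. r \<ge> 1 \<and> c (int r) \<noteq> 0} \<subseteq> {1..K}"
    by auto
  then show "(\<Sum>s | s \<ge> 1 \<and> c (- int s) \<noteq> 0. of_int (c (- int s)) * ((-1) ^ s / fact (s + 1)))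
       = (\<Sum>s=1..K. of_int (c (- int s)) * ((-1) ^ s / fact (s + 1)) :: rat)"
    and "(\<Sum>r | r \<ge> 1 \<and> c (int r) \<noteq> 0. of_int (c (int r)) * (-1) ^ (r + 1) * fact r)
       = (\<Sum>r=1..K. of_int (c (int r)) * (-1) ^ (r + 1) * fact r :: rat)"
    by (intro sum.mono_neutral_left; auto)+
qed

lemma is_expansion_iff:
  assumes "\<And>s. s > K \<Longrightarrow> c (- int s) = 0" "\<And>r. r > K \<Longrightarrow> c (int r) = 0"
  shows "is_expansion q c \<longleftrightarrow>
     c 0 = 0 \<and> finite {t. c t \<noteq> 0} \<and>
     (\<forall>s::nat. s \<ge> 1 \<longrightarrow> 0 \<le> c (- int s) \<and> c (- int s) \<le> int s) \<and>
     (\<forall>r::nat. r \<ge> 1 \<longrightarrow> 0 \<le> c (int r) \<and> c (int r) \<le> int r) \<and>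
     q = (\<Sum>s=1..K. of_int (c (- int s)) * ((-1) ^ s / fact (s + 1)))
       + (\<Sum>r=1..K. of_int (c (int r)) * (-1) ^ (r + 1) * fact r)"
  unfolding is_expansion_def
  by (subst expansion_sums_eq(1)[where c = c, OF assms], assumption+)
     (subst expansion_sums_eq(2)[where c = c, OF assms], assumption+, rule refl)

lemma frac_digits_unique:
  fixes e :: "nat \<Rightarrow> int"
  assumes "\<And>s. s \<ge> 1 \<Longrightarrow> \<bar>e s\<bar> \<le> int s"
    and "(\<Sum>s=1..M. of_int (e s) * ((-1) ^ s / fact (s + 1))) \<in> (\<int> :: rat set)"
  shows "\<forall>s\<in>{1..M}. e s = 0"
  using assms(2)
proof (induction M)
  case (Suc M)
  let ?S = "\<lambda>M. (\<Sum>s=1..M. of_int (e s) * ((-1) ^ s / fact (s + 1))) :: rat"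
  have "fact (M + 1) * ?S M \<in> \<int>"
    unfolding sum_distrib_left
  proof (rule Ints_sum)
    fix s assume s: "s \<in> {1..M}"
    have "fact (s + 1) dvd (fact (M + 1) :: int)"
      using s by (intro fact_dvd) auto
    then obtain w :: int where "fact (M + 1) = fact (s + 1) * w" by (elim dvdE)
    then have "(fact (M + 1) :: rat) = fact (s + 1) * of_int w" by (metis of_int_fact of_int_mult)
    then have "fact (M + 1) * (of_int (e s) * ((-1) ^ s / fact (s + 1)))
        = (of_int (e s) * (-1) ^ s * of_int w :: rat)"
      by (simp del: fact_Suc)
    then show "fact (M + 1) * (of_int (e s) * ((-1) ^ s / fact (s + 1))) \<in> (\<int> :: rat set)"
      by simp
  qed
  moreover have "fact (M + 1) * ?S (Suc M) \<in> \<int>"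
    using Suc.prems by (intro Ints_mult) (auto simp del: fact_Suc intro: fact_in_Ints)
  ultimately have "fact (M + 1) * ?S (Suc M) - fact (M + 1) * ?S M \<in> \<int>" by (rule Ints_diff[rotated])
  moreover have "fact (M + 1) * ?S (Suc M) - fact (M + 1) * ?S M
      = of_int (e (Suc M)) * (-1) ^ Suc M / of_nat (M + 2)"
  proof -
    have F: "fact (Suc M + 1) = (of_nat (M + 2) * fact (M + 1) :: rat)" by simp
    have S: "?S (Suc M) = ?S M + of_int (e (Suc M)) * ((-1) ^ Suc M / fact (Suc M + 1))" by simp
    have "(fact (M + 1) :: rat) \<noteq> 0" by (rule fact_nonzero)
    then show ?thesis unfolding S F distrib_left by simp
  qed
  ultimately obtain z where "of_int (e (Suc M)) * (-1) ^ Suc M / of_nat (M + 2) = (of_int z :: rat)"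
    unfolding Ints_def by (metis (no_types, lifting) imageE)
  moreover have "(of_nat (M + 2) :: rat) \<noteq> 0" by (simp only: of_nat_eq_0_iff)
  ultimately have "of_int (e (Suc M)) * (-1) ^ Suc M = (of_int z * of_nat (M + 2) :: rat)"
    by (metis nonzero_divide_eq_eq)
  then have "of_int (e (Suc M) * (-1) ^ Suc M) = (of_int (z * int (M + 2)) :: rat)"
    by (simp only: of_int_mult of_int_power of_int_minus of_int_1 of_int_of_nat_eq)
  then have "e (Suc M) * (-1) ^ Suc M = z * int (M + 2)" by (simp only: of_int_eq_iff)
  then have "int (M + 2) dvd e (Suc M) * (-1) ^ Suc M" by simp
  then have "int (M + 2) dvd e (Suc M)"
    by (cases "even M") auto
  with assms(1)[of "Suc M"] have 0: "e (Suc M) = 0"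
    using zdvd_imp_le[of "int (M+2)" "\<bar>e (Suc M)\<bar>"] by auto
  with Suc show ?case by (auto simp: le_Suc_eq)
qed simp

lemma int_digits_unique:
  fixes e :: "nat \<Rightarrow> int"
  assumes b: "\<And>r. r \<ge> 1 \<Longrightarrow> \<bar>e r\<bar> \<le> int r"
    and 0: "(\<Sum>r=1..N. e r * (-1) ^ (r + 1) * fact r) = 0"
  shows "r \<in> {1..N} \<Longrightarrow> e r = 0"
proof (induction r rule: less_induct)
  case (less r)
  have "(\<Sum>r=1..N. e r * (-1) ^ (r + 1) * fact r) = (\<Sum>j=r..N. e j * (-1) ^ (j + 1) * fact j)"
    using less by (intro sum.mono_neutral_right) (auto simp: not_le)
  also have "\<dots> = e r * (-1) ^ (r + 1) * fact r + (\<Sum>j=Suc r..N. e j * (-1) ^ (j + 1) * fact j)"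
    using less by (intro sum.atLeast_Suc_atMost) auto
  finally have *: "e r * (-1) ^ (r + 1) * fact r = - (\<Sum>j=Suc r..N. e j * (-1) ^ (j + 1) * fact j)"
    using 0 by simp
  have "fact (Suc r) dvd (\<Sum>j=Suc r..N. e j * (-1) ^ (j + 1) * fact j)"
    by (intro dvd_sum dvd_mult fact_dvd) auto
  then have "int (Suc r) * fact r dvd (e r * (-1) ^ (r + 1)) * fact r"
    unfolding * by (simp add: algebra_simps)
  then have "int (Suc r) dvd e r * (-1) ^ (r + 1)" by (subst (asm) dvd_mult_cancel_right) simp
  then have "int (Suc r) dvd e r"
    by (cases "even r") auto
  with b[of r] less.prems show ?case
    using zdvd_imp_le[of "int (Suc r)" "\<bar>e r\<bar>"] by auto
qed

lemma expansion_unique: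
  assumes "is_expansion q c" "is_expansion q c'"
  shows "c = c'"
proof -
  obtain K where K: "\<And>s. s > K \<Longrightarrow> c (- int s) = 0" "\<And>r. r > K \<Longrightarrow> c (int r) = 0"
    using expansion_sums[of c] assms unfolding is_expansion_def by metis
  obtain K' where K': "\<And>s. s > K' \<Longrightarrow> c' (- int s) = 0" "\<And>r. r > K' \<Longrightarrow> c' (int r) = 0"
    using expansion_sums[of c'] assms unfolding is_expansion_def by metis
  define L where "L = max K K'"
  have L: "\<And>s. s > L \<Longrightarrow> c (- int s) = 0" "\<And>r. r > L \<Longrightarrow> c (int r) = 0"
    "\<And>s. s > L \<Longrightarrow> c' (- int s) = 0" "\<And>r. r > L \<Longrightarrow> c' (int r) = 0"
    using K K' by (auto simp: L_def)
  define e where "e t = c t - c' t" for t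
  have b: "\<And>s. s \<ge> 1 \<Longrightarrow> \<bar>e (- int s)\<bar> \<le> int s" "\<And>r. r \<ge> 1 \<Longrightarrow> \<bar>e (int r)\<bar> \<le> int r"
    using assms unfolding is_expansion_def e_def by (smt (verit))+
  have eq: "(\<Sum>s=1..L. of_int (e (- int s)) * ((-1) ^ s / fact (s + 1)))
      + (\<Sum>r=1..L. of_int (e (int r)) * (-1) ^ (r + 1) * fact r) = (0 :: rat)"
  proof -
    have "q = (\<Sum>s=1..L. of_int (c (- int s)) * ((-1) ^ s / fact (s + 1)))
      + (\<Sum>r=1..L. of_int (c (int r)) * (-1) ^ (r + 1) * fact r)"
      using assms(1) is_expansion_iff[of L c q, OF L(1,2)] by blast
    moreover have "q = (\<Sum>s=1..L. of_int (c' (- int s)) * ((-1) ^ s / fact (s + 1)))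
      + (\<Sum>r=1..L. of_int (c' (int r)) * (-1) ^ (r + 1) * fact r)"
      using assms(2) is_expansion_iff[of L c' q, OF L(3,4)] by blast
    ultimately show ?thesis
      unfolding e_def of_int_diff left_diff_distrib sum_subtractf by linarith
  qed
  have "(\<Sum>s=1..L. of_int (e (- int s)) * ((-1) ^ s / fact (s + 1)))
      = (of_int (- (\<Sum>r=1..L. e (int r) * (-1) ^ (r + 1) * fact r)) :: rat)"
    using eq by (simp add: eq_neg_iff_add_eq_0)
  then have "\<forall>s\<in>{1..L}. e (- int s) = 0"
    by (intro frac_digits_unique b) (auto simp del: of_int_minus)
  then have neg: "e (- int s) = 0" if "s \<ge> 1" for s using that L by (cases "s \<le> L") (auto simp: e_def)
  have "of_int (\<Sum>r=1..L. e (int r) * (-1) ^ (r + 1) * fact r) = (0 :: rat)"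
    using eq neg by simp
  then have "(\<Sum>r=1..L. e (int r) * (-1) ^ (r + 1) * fact r) = 0"
    by (simp only: of_int_eq_0_iff)
  then have "e (int r) = 0" if "r \<in> {1..L}" for r
    using int_digits_unique[of "\<lambda>r. e (int r)" L r] b(2) that by blast
  then have pos: "e (int r) = 0" if "r \<ge> 1" for r using that L by (cases "r \<le> L") (auto simp: e_def)
  have "e t = 0" for t
  proof (cases t "0::int" rule: linorder_cases)
    case less then show ?thesis using neg[of "nat (- t)"] by simp
  next
    case equal then show ?thesis using assms by (simp add: e_def is_expansion_def)
  next
    case greater then show ?thesis using pos[of "nat t"] by simp
  qed
  then show ?thesis by (auto simp: e_def)
qed

lemma int_digits_exist:
  fixes n :: int
  assumes "a \<ge> 1"
  shows "\<exists>d N. (\<forall>r. 0 \<le> d r \<and> d r \<le> int r) \<and> (\<forall>r. r < a \<or> r > N \<longrightarrow> d r = 0) \<and>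
    n * (-1) ^ (a + 1) * fact a = (\<Sum>r=1..N. d r * (-1) ^ (r + 1) * fact r)"
  using assms
proof (induction "nat (2 * \<bar>n\<bar> + (if n < 0 then 1 else 0))" arbitrary: n a rule: less_induct)
  case less
  show ?case
  proof (cases "n = 0")
    case True
    then show ?thesis by (intro exI[of _ "\<lambda>_. 0"]) auto
  next
    case False
    define b where "b = int (Suc a)"
    define d0 where "d0 = n mod b"
    define n1 where "n1 = - (n div b)"
    have b: "b \<ge> 2" using less.prems by (simp add: b_def)
    have d0: "0 \<le> d0" "d0 < b" using b by (auto simp: d0_def)
    have n: "n = d0 - b * n1" by (simp add: d0_def n1_def)
    have "nat (2 * \<bar>n1\<bar> + (if n1 < 0 then 1 else 0)) < nat (2 * \<bar>n\<bar> + (if n < 0 then 1 else 0))"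
    proof (cases "n > 0")
      case True
      have "n div b \<le> n div 2" using True b by (intro zdiv_mono2) auto
      moreover have "n div b \<ge> 0" using True b by (simp add: pos_imp_zdiv_nonneg_iff)
      ultimately show ?thesis using True by (auto simp: n1_def)
    next
      case neg: False
      with False have neg: "n < 0" by simp
      have "n1 > 0"
      proof (rule ccontr)
        assume "\<not> n1 > 0"
        then have "b * n1 \<le> 0" using b by (simp add: mult_nonneg_nonpos)
        then show False using neg n d0 by linarith
      qed
      moreover have "n1 \<le> - n"
      proof (rule ccontr)
        assume "\<not> n1 \<le> - n"
        then have "b * (1 - n) \<le> b * n1" using b by (intro mult_left_mono) auto
        moreover have "2 * (- n) \<le> b * (- n)" using b neg by (intro mult_right_mono) auto
        ultimately show False using neg n d0 by (simp add: algebra_simps)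
      qed
      ultimately show ?thesis using neg by simp
    qed
    from less.hyps[OF this, of "Suc a"] obtain d N where
      d: "\<forall>r. 0 \<le> d r \<and> d r \<le> int r" "\<forall>r. r < Suc a \<or> r > N \<longrightarrow> d r = 0"
      and s: "n1 * (-1) ^ (Suc a + 1) * fact (Suc a) = (\<Sum>r=1..N. d r * (-1) ^ (r + 1) * fact r)"
      by auto
    define N' where "N' = max N a"
    have s': "n1 * (-1) ^ (Suc a + 1) * fact (Suc a) = (\<Sum>r=1..N'. d r * (-1) ^ (r + 1) * fact r)"
      unfolding s by (rule sum.mono_neutral_left) (use d in \<open>auto simp: N'_def not_le\<close>)
    have "(\<Sum>r=1..N'. (d(a := d0)) r * (-1) ^ (r + 1) * fact r)
      = (\<Sum>r=1..N'. d r * (-1) ^ (r + 1) * fact r + (if r = a then d0 * (-1) ^ (a + 1) * fact a else 0))"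
      using d(2) by (intro sum.cong) auto
    also have "\<dots> = n1 * (-1) ^ (Suc a + 1) * fact (Suc a) + d0 * (-1) ^ (a + 1) * fact a"
      using less.prems unfolding sum.distrib s'[symmetric] by (simp add: N'_def)
    also have "\<dots> = n * (-1) ^ (a + 1) * fact a"
      unfolding n b_def by (simp add: algebra_simps)
    finally show ?thesis using d d0
      by (intro exI[of _ "d(a := d0)"] exI[of _ N']) (auto simp: N'_def b_def)
  qed
qed

lemma frac_digits_exist:
  fixes q :: rat
  assumes "q * fact (M + 1) \<in> \<int>"
  shows "\<exists>d n. (\<forall>s. 0 \<le> d s \<and> d s \<le> int s) \<and> (\<forall>s>M. d s = 0) \<and>
    q = (\<Sum>s=1..M. of_int (d s) * ((-1) ^ s / fact (s + 1))) + of_int n"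
  using assms
proof (induction M arbitrary: q)
  case 0
  then show ?case by (intro exI[of _ "\<lambda>_. 0"]) (auto elim!: Ints_cases)
next
  case (Suc M)
  obtain z where z: "q * fact (Suc M + 1) = of_int z" using Suc.prems by (rule Ints_cases)
  define b where "b = int (M + 2)"
  define y where "y = z * (-1) ^ Suc M"
  define d0 where "d0 = y mod b"
  have d0: "0 \<le> d0" "d0 \<le> int (Suc M)"
    using pos_mod_sign[of b y] pos_mod_bound[of b y] unfolding d0_def[symmetric]
    by (simp_all add: b_def)
  have yz: "z = y * (-1) ^ Suc M" by (simp add: y_def mult.assoc flip: power_add power_mult_distrib)
  have z': "z = d0 * (-1) ^ Suc M + b * (y div b * (-1) ^ Suc M)"
    by (subst yz, subst mult_div_mod_eq[symmetric, of y b]) (simp only: d0_def distrib_right mult.assoc add.commute)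
  have F: "fact (Suc M + 1) = (of_int b * fact (M + 1) :: rat)" by (simp add: b_def)
  have "(q - of_int d0 * ((-1) ^ Suc M / fact (Suc M + 1))) * fact (Suc M + 1)
      = of_int z - of_int d0 * (-1) ^ Suc M"
  proof -
    have "(fact (Suc M + 1) :: rat) \<noteq> 0" by (rule fact_nonzero)
    then have "of_int d0 * ((-1) ^ Suc M / fact (Suc M + 1)) * fact (Suc M + 1)
      = (of_int d0 * (-1) ^ Suc M :: rat)" by (metis nonzero_eq_divide_eq times_divide_eq_right)
    then show ?thesis by (simp only: left_diff_distrib z)
  qed
  also have "\<dots> = of_int (b * (y div b * (-1) ^ Suc M))"
    by (subst z') simp
  finally have "of_int b * ((q - of_int d0 * ((-1) ^ Suc M / fact (Suc M + 1))) * fact (M + 1))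
      = of_int b * of_int (y div b * (-1) ^ Suc M)"
    by (simp only: F mult.assoc mult.left_commute[of _ "of_int b"] of_int_mult)
  then have "(q - of_int d0 * ((-1) ^ Suc M / fact (Suc M + 1))) * fact (M + 1)
      = of_int (y div b * (-1) ^ Suc M)"
    by (subst (asm) mult_cancel_left) (auto simp: b_def)
  then have "(q - of_int d0 * ((-1) ^ Suc M / fact (Suc M + 1))) * fact (M + 1) \<in> \<int>"
    by (metis Ints_of_int)
  from Suc.IH[OF this] obtain d n where d: "\<forall>s. 0 \<le> d s \<and> d s \<le> int s" "\<forall>s>M. d s = 0"
    and s: "q - of_int d0 * ((-1) ^ Suc M / fact (Suc M + 1))
      = (\<Sum>s=1..M. of_int (d s) * ((-1) ^ s / fact (s + 1))) + of_int n" by blast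
  have "(\<Sum>s=1..Suc M. of_int ((d(Suc M := d0)) s) * ((-1) ^ s / fact (s + 1)))
     = (\<Sum>s=1..M. of_int (d s) * ((-1) ^ s / fact (s + 1)))
       + (of_int d0 * ((-1) ^ Suc M / fact (Suc M + 1)) :: rat)"
    by (simp del: fact_Suc)
  then have "q = (\<Sum>s=1..Suc M. of_int ((d(Suc M := d0)) s) * ((-1) ^ s / fact (s + 1))) + of_int n"
    using s by linarith
  then show ?case using d d0
    by (intro exI[of _ "d(Suc M := d0)"] exI[of _ n]) (auto simp del: fact_Suc)
qed

lemma expansion_exists: "\<exists>c. is_expansion q c"
proof -
  obtain a b where ab: "quotient_of q = (a, b)" by fastforce
  then have b: "b > 0" and q: "q = of_int a / of_int b"
    using quotient_of_denom_pos quotient_of_div by auto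
  define M where "M = nat b"
  have "b dvd fact (M + 1)"
    using b dvd_fact[of "nat b" "M + 1"] by (metis M_def int_dvd_int_iff int_nat_eq le_add1 less_imp_le of_nat_fact nat_0_less_mult_iff One_nat_def Suc_leI zero_less_nat_eq)
  then obtain w :: int where "fact (M + 1) = b * w" by (elim dvdE)
  then have "fact (M + 1) = (of_int (b * w) :: rat)" by (metis of_int_fact)
  then have "q * fact (M + 1) = of_int (a * w)" using b q by simp
  then have "q * fact (M + 1) \<in> \<int>" by (metis Ints_of_int)
  from frac_digits_exist[OF this] obtain d n where
    d: "\<forall>s. 0 \<le> d s \<and> d s \<le> int s" "\<forall>s>M. d s = 0"
    and qd: "q = (\<Sum>s=1..M. of_int (d s) * ((-1) ^ s / fact (s + 1))) + of_int n" by blast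
  from int_digits_exist[of 1 n] obtain g N where
    g: "\<forall>r. 0 \<le> g r \<and> g r \<le> int r" "\<forall>r. r < 1 \<or> r > N \<longrightarrow> g r = 0"
    and ng: "n = (\<Sum>r=1..N. g r * (-1) ^ (r + 1) * fact r)" by auto
  define c where "c t = (if t < 0 then d (nat (- t)) else g (nat t))" for t
  define K where "K = max M N"
  have cd: "c (- int s) = d s" if "s \<ge> 1" for s using that by (simp add: c_def)
  have cg: "c (int r) = g r" for r by (simp add: c_def)
  have K: "c (- int s) = 0" "c (int s) = 0" if "s > K" for s
    using that d(2) g(2) by (auto simp: cd cg K_def)
  have "{t. c t \<noteq> 0} \<subseteq> {- int K..int K}"
  proof safe
    fix t assume t: "c t \<noteq> 0"
    show "t \<in> {- int K..int K}"
      using t K(1)[of "nat (- t)"] K(2)[of "nat t"] by (cases "t < 0") force+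
  qed
  then have "finite {t. c t \<noteq> 0}" by (rule finite_subset) simp
  moreover have "q = (\<Sum>s=1..K. of_int (c (- int s)) * ((-1) ^ s / fact (s + 1)))
      + (\<Sum>r=1..K. of_int (c (int r)) * (-1) ^ (r + 1) * fact r)"
  proof -
    have "(\<Sum>s=1..M. of_int (d s) * ((-1) ^ s / fact (s + 1)))
       = (\<Sum>s=1..K. of_int (c (- int s)) * ((-1) ^ s / fact (s + 1)) :: rat)"
      by (rule sum.mono_neutral_cong_left) (use d cd in \<open>auto simp: K_def not_le\<close>)
    moreover have "n = (\<Sum>r=1..K. c (int r) * (-1) ^ (r + 1) * fact r)"
      unfolding ng by (rule sum.mono_neutral_cong_left) (use g cg in \<open>auto simp: K_def not_le\<close>)
    ultimately show ?thesis using qd by simp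
  qed
  moreover have "c 0 = 0" using g(2) by (simp add: c_def)
  moreover have "\<forall>s::nat. s \<ge> 1 \<longrightarrow> 0 \<le> c (- int s) \<and> c (- int s) \<le> int s" using d(1) cd by simp
  moreover have "\<forall>r::nat. r \<ge> 1 \<longrightarrow> 0 \<le> c (int r) \<and> c (int r) \<le> int r" using g(1) cg by simp
  ultimately have "is_expansion q c" using is_expansion_iff[of K c q, OF K] by blast
  then show ?thesis by blast
qed

lemma ex1_expansion: "\<exists>!c. is_expansion q c"
proof -
  obtain c where c: "is_expansion q c" using expansion_exists by blast
  show ?thesis using c expansion_unique[OF _ c] by (intro ex1I)
qed

lemma is_expansion_digit: "is_expansion q (digit q)"
  unfolding digit_def by (rule theI'[OF ex1_expansion])

lemma finite_rat_dom: "finite (rat_dom q)"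
proof (rule finite_subset)
  show "rat_dom q \<subseteq> {t. digit q t \<noteq> 0}" by (auto simp: rat_dom_def)
  show "finite {t. digit q t \<noteq> 0}" using is_expansion_digit[of q] by (simp add: is_expansion_def)
qed

end

theory Submission
  imports Defs "HOL-Analysis.Kronecker_Approximation_Theorem"
begin

text \<open>
  The integer \<open>\<gamma>\<close> is chosen first, as a multiple \<open>n a!\<close> with \<open>a > k\<^sub>2\<close>: its digits below index \<open>a\<close>
  vanish, and \<open>n\<close> can be taken so that \<open>\<delta>\<gamma>\<^sup>2 = (\<delta> a!\<^sup>2) n\<^sup>2\<close> is very close to an integer. Afterwards
  \<open>\<beta> = (-1)\<^sup>s/(s+1)!\<close> with \<open>s\<close> so large that \<open>\<delta>\<beta>\<^sup>2\<close> and \<open>\<delta>\<beta>\<gamma>\<close> are negligible.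

  That \<open>\<alpha> n\<^sup>2\<close> comes arbitrarily close to integers follows from Dirichlet's simultaneous
  approximation theorem and the pigeonhole principle. Choose positive integers \<open>x\<^sub>0, x\<^sub>1, \<dots>\<close>
  successively so that \<open>2\<alpha> x\<^sub>j (x\<^sub>i + \<dots> + x\<^sub>j\<^sub>-\<^sub>1)\<close> is almost an integer for all \<open>i < j\<close>. Then
  \<open>\<alpha>(x\<^sub>i + \<dots> + x\<^sub>j\<^sub>-\<^sub>1)\<^sup>2\<close> is modulo 1 almost \<open>\<alpha>x\<^sub>i\<^sup>2 + \<dots> + \<alpha>x\<^sub>j\<^sub>-\<^sub>1\<^sup>2\<close>, a difference of two of the
  partial sums of \<open>\<Sum>\<alpha>x\<^sub>l\<^sup>2\<close>, and two of these are close modulo 1. Below, \<open>S j = x\<^sub>0 + \<dots> + x\<^sub>j\<^sub>-\<^sub>1\<close>.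
\<close>

section \<open>Squares whose multiples are close to integers\<close>

text \<open>Induction on \<open>J\<close>: once \<open>S 0, ..., S J\<close> are fixed, Dirichlet's
  theorem for the \<open>J + 1\<close> numbers \<open>2 * \<alpha> * (S J - S i)\<close> gives a
  single positive multiplier \<open>x\<close> that serves all \<open>i\<close>, and \<open>x\<close>
  becomes the next step.\<close>

lemma almost_orthogonal_steps_exist:
  fixes \<alpha> :: real and N J :: nat
  assumes "N > 0"
  shows "\<exists>S :: nat \<Rightarrow> int. \<forall>j<J. S j < S (Suc j) \<and>
    (\<forall>i\<le>j. \<exists>m::int. \<bar>2 * \<alpha> * of_int (S (Suc j) - S j) * of_int (S j - S i) - of_int m\<bar> < 1 / real N)"
proof (induction J)
  case 0
  then show ?case by simp
next
  case (Suc J)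
  then obtain S :: "nat \<Rightarrow> int" where S: "\<forall>j<J. S j < S (Suc j) \<and>
    (\<forall>i\<le>j. \<exists>m::int. \<bar>2 * \<alpha> * of_int (S (Suc j) - S j) * of_int (S j - S i) - of_int m\<bar> < 1 / real N)"
    by blast
  obtain x p where x: "0 < x"
    "\<And>i. i < Suc J \<Longrightarrow> \<bar>of_int x * (2 * \<alpha> * of_int (S J - S i)) - of_int (p i)\<bar> < 1 / real N"
    using Dirichlet_approx_simult[OF assms, of "Suc J" "\<lambda>i. 2 * \<alpha> * of_int (S J - S i)"] by metis
  define S' where "S' = S(Suc J := S J + x)"
  have S'_old: "S' j = S j" if "j \<le> J" for j
    using that by (simp add: S'_def)
  have S'_new: "S' (Suc J) = S J + x"
    by (simp add: S'_def)
  have "S' j < S' (Suc j) \<and>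
    (\<forall>i\<le>j. \<exists>m::int. \<bar>2 * \<alpha> * of_int (S' (Suc j) - S' j) * of_int (S' j - S' i) - of_int m\<bar> < 1 / real N)"
    if "j < Suc J" for j
  proof (cases "j = J")
    case True
    have "\<bar>2 * \<alpha> * of_int (S' (Suc J) - S' J) * of_int (S' J - S' i) - of_int (p i)\<bar> < 1 / real N"
      if "i \<le> J" for i
      using x(2)[of i] that by (simp add: S'_old S'_new mult_ac)
    then show ?thesis
      using x(1) True by (auto simp: S'_old S'_new)
  next
    case False
    with that have "j < J" by simp
    then show ?thesis
      using S by (simp add: S'_old)
  qed
  then show ?case by blast
qed

text \<open>Appending one step to \<open>S j - S i\<close> adds to the square the step's own square
  and a cross term that \<open>steps\<close> puts within \<open>\<eta>\<close> of an integer, so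
  errors grow by at most \<open>\<eta>\<close> per step.\<close>

lemma square_near_sum_of_squares:
  fixes S :: "nat \<Rightarrow> int" and \<alpha> \<eta> :: real
  assumes steps: "\<And>i j. i \<le> j \<Longrightarrow> j < J \<Longrightarrow>
      \<exists>m::int. \<bar>2 * \<alpha> * of_int (S (Suc j) - S j) * of_int (S j - S i) - of_int m\<bar> < \<eta>"
    and "i \<le> j" "j \<le> J"
  shows "\<exists>m::int. \<bar>\<alpha> * (of_int (S j - S i))\<^sup>2
      - (\<Sum>l=i..<j. \<alpha> * (of_int (S (Suc l) - S l))\<^sup>2) - of_int m\<bar> \<le> real (j - i) * \<eta>"
  using assms(2,3)
proof (induction j rule: dec_induct)
  case base
  then show ?case by (intro exI[of _ 0]) simp
next
  case (step j)
  define P where "P = \<alpha> * (of_int (S j - S i))\<^sup>2"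
  define Q where "Q = (\<Sum>l=i..<j. \<alpha> * (of_int (S (Suc l) - S l))\<^sup>2)"
  define R where "R = 2 * \<alpha> * of_int (S (Suc j) - S j) * of_int (S j - S i)"
  define T where "T = \<alpha> * (of_int (S (Suc j) - S j))\<^sup>2"
  obtain m :: int where m: "\<bar>P - Q - of_int m\<bar> \<le> real (j - i) * \<eta>"
    using step unfolding P_def Q_def by auto
  obtain m' :: int where m': "\<bar>R - of_int m'\<bar> < \<eta>"
    using steps[of i j] step unfolding R_def by auto
  have sq: "\<alpha> * (of_int (S (Suc j) - S i))\<^sup>2 = P + R + T"
    by (simp add: P_def R_def T_def power2_eq_square algebra_simps)
  have sum: "(\<Sum>l=i..<Suc j. \<alpha> * (of_int (S (Suc l) - S l))\<^sup>2) = Q + T"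
    using step by (simp add: Q_def T_def)
  have "real (Suc j - i) * \<eta> = real (j - i) * \<eta> + \<eta>"
    using step by (simp add: Suc_diff_le algebra_simps)
  then have "\<bar>(P + R + T) - (Q + T) - of_int (m + m')\<bar> \<le> real (Suc j - i) * \<eta>"
    using m m' unfolding of_int_add by linarith
  then show ?case
    unfolding sq sum by blast
qed

text \<open>The \<open>N + 1\<close> fractional parts fall into \<open>N\<close> half-open intervals
  of length \<open>1 / N\<close>; \<open>g\<close> below records the interval.\<close>

lemma pigeonhole_mod_1:
  fixes f :: "nat \<Rightarrow> real"
  assumes "N > 0"
  obtains i j and m :: int where "i < j" "j \<le> N" "\<bar>f j - f i - of_int m\<bar> < 1 / real N"
proof -
  define g where "g j = nat \<lfloor>frac (f j) * real N\<rfloor>" for j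
  have "g j < N" for j
  proof -
    have "frac (f j) * real N < real N"
      using assms frac_lt_1[of "f j"] by simp
    then have "\<lfloor>frac (f j) * real N\<rfloor> < int N"
      by (simp add: floor_less_iff)
    then show ?thesis
      using assms by (simp add: g_def nat_less_iff)
  qed
  then have "card (g ` {..N}) \<le> card {..<N}"
    by (intro card_mono) auto
  then have "\<not> inj_on g {..N}"
    by (intro pigeonhole) simp
  then obtain i j where ij: "i < j" "j \<le> N" "g i = g j"
    unfolding inj_on_def by (metis atMost_iff linorder_neqE_nat)
  have ge: "0 \<le> frac (f j) * real N" for j
    by simp
  have "\<lfloor>frac (f i) * real N\<rfloor> = \<lfloor>frac (f j) * real N\<rfloor>"
    using ij(3) ge[of i] ge[of j] unfolding g_def by (metis eq_nat_nat_iff zero_le_floor)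
  then have "\<bar>frac (f j) * real N - frac (f i) * real N\<bar> < 1"
    by linarith
  then have "\<bar>frac (f j) - frac (f i)\<bar> * real N < 1"
    by (simp add: abs_mult flip: left_diff_distrib)
  then have "\<bar>frac (f j) - frac (f i)\<bar> < 1 / real N"
    using assms by (simp add: field_simps)
  then have "\<bar>f j - f i - of_int (\<lfloor>f j\<rfloor> - \<lfloor>f i\<rfloor>)\<bar> < 1 / real N"
    by (simp add: frac_def algebra_simps)
  with ij show ?thesis using that by blast
qed

theorem square_multiple_near_int:
  fixes \<alpha> \<epsilon> :: real
  assumes "\<epsilon> > 0"
  obtains n m :: int where "n > 0" "\<bar>\<alpha> * (of_int n)\<^sup>2 - of_int m\<bar> < \<epsilon>"
proof -
  obtain N :: nat where N: "2 / \<epsilon> < real N"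
    using reals_Archimedean2 by blast
  then have "N > 0"
    using assms by (metis divide_pos_pos less_trans of_nat_0_less_iff zero_less_numeral)
  then have "N * N > 0" by simp
  \<comment> \<open>The precision is \<open>1 / (N * N)\<close> because up to \<open>N\<close>
    errors accumulate; together they cost at most \<open>1 / N\<close>, and the pigeonhole step
    costs another \<open>1 / N\<close>.\<close>
  from almost_orthogonal_steps_exist[OF this, of N \<alpha>] obtain S :: "nat \<Rightarrow> int" where
    S: "\<And>j. j < N \<Longrightarrow> S j < S (Suc j)"
    and steps: "\<And>i j. i \<le> j \<Longrightarrow> j < N \<Longrightarrow> \<exists>m::int.
      \<bar>2 * \<alpha> * of_int (S (Suc j) - S j) * of_int (S j - S i) - of_int m\<bar> < 1 / real (N * N)"
    by blast
  define h where "h l = \<alpha> * (of_int (S (Suc l) - S l))\<^sup>2" for l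
  obtain i j and m :: int where ij: "i < j" "j \<le> N"
    and m: "\<bar>(\<Sum>l<j. h l) - (\<Sum>l<i. h l) - of_int m\<bar> < 1 / real N"
    using pigeonhole_mod_1[OF \<open>N > 0\<close>, of "\<lambda>j. \<Sum>l<j. h l"] by blast
  obtain m' :: int where m': "\<bar>\<alpha> * (of_int (S j - S i))\<^sup>2 - (\<Sum>l=i..<j. h l) - of_int m'\<bar>
      \<le> real (j - i) * (1 / real (N * N))"
    using square_near_sum_of_squares[where J = N and S = S and \<alpha> = \<alpha>, OF steps, of i j] ij
    unfolding h_def by auto
  have "(\<Sum>l<j. h l) - (\<Sum>l<i. h l) = (\<Sum>l=i..<j. h l)"
    using sum_diff_nat_ivl[of 0 i j h] ij by (simp add: atLeast0LessThan)
  moreover have "real (j - i) * (1 / real (N * N)) \<le> real N * (1 / real (N * N))"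
    using ij by (intro mult_right_mono) auto
  moreover have "real N * (1 / real (N * N)) = 1 / real N"
    using \<open>N > 0\<close> by simp
  moreover have "1 / real N + 1 / real N < \<epsilon>"
  proof -
    have "2 / real N < \<epsilon>"
      using N \<open>N > 0\<close> assms by (simp add: pos_divide_less_eq mult.commute)
    then show ?thesis by simp
  qed
  ultimately have "\<bar>\<alpha> * (of_int (S j - S i))\<^sup>2 - of_int (m + m')\<bar> < \<epsilon>"
    using m m' by simp
  \<comment> \<open>Positive steps exclude the trivial solution \<open>n = 0\<close>.\<close>
  moreover have "S i < S j"
    using Suc_leI[OF ij(1)] ij(2)
  proof (induction j rule: dec_induct)
    case base
    then show ?case using S by simp
  next
    case (step l)
    then show ?case using S[of l] by simp
  qed
  ultimately show ?thesis
    using that[of "S j - S i" "m + m'"] by simp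
qed

section \<open>Domains of the chosen rationals\<close>

lemma digit_eqI: "is_expansion q c \<Longrightarrow> digit q = c"
  using expansion_unique is_expansion_digit by blast

lemma rat_dom_signed_inverse_fact:
  assumes "s \<ge> 1"
  shows "rat_dom ((-1) ^ s / fact (s + 1)) = {- int s}"
proof -
  define c where "c t = (if t = - int s then 1 else 0 :: int)" for t
  have c: "{t. c t \<noteq> 0} = {- int s}"
    by (auto simp: c_def)
  have "{r. r \<ge> 1 \<and> c (- int r) \<noteq> 0} = {s}" "{r. r \<ge> 1 \<and> c (int r) \<noteq> 0} = {}"
    using assms by (auto simp: c_def)
  then have "is_expansion ((-1) ^ s / fact (s + 1)) c"
    unfolding is_expansion_def using assms by (auto simp: c c_def simp del: fact_Suc)
  from digit_eqI[OF this] show ?thesis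
    using assms c by (auto simp: rat_dom_def c_def)
qed

text \<open>The greedy expansion of a multiple of \<open>fact a\<close> can start at index
  \<open>a\<close>, and by uniqueness it is the expansion. Only an inclusion holds in general, as
  \<open>n = 0\<close> has empty domain.\<close>

lemma rat_dom_int_multiple_fact:
  fixes n :: int
  assumes "a \<ge> 1"
  shows "rat_dom (of_int (n * fact a)) \<subseteq> {int a..}"
proof -
  \<comment> \<open>The sign cancels the factor \<open>(-1) ^ (a + 1)\<close> built into
    \<open>int_digits_exist\<close>.\<close>
  define n' where "n' = n * (-1) ^ (a + 1)"
  obtain d N where d: "\<forall>r. 0 \<le> d r \<and> d r \<le> int r" "\<forall>r. r < a \<or> r > N \<longrightarrow> d r = 0"
    and s: "n' * (-1) ^ (a + 1) * fact a = (\<Sum>r=1..N. d r * (-1) ^ (r + 1) * fact r)"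
    using int_digits_exist[OF assms, of n'] by blast
  have n: "n * fact a = n' * (-1) ^ (a + 1) * fact a"
    by (simp add: n'_def mult.assoc flip: power_add power_mult_distrib)
  define c where "c t = (if t < 0 then 0 else d (nat t))" for t
  have c_zero: "c t = 0" if "t < int a \<or> t > int N" for t
    using that d(2) by (cases "t < 0") (auto simp: c_def nat_less_iff zless_nat_eq_int_zless)
  have c_nat: "c (int r) = d r" for r
    by (simp add: c_def)
  \<comment> \<open>For \<open>s = 0\<close> the value is \<open>d 0\<close>, which vanishes because
    \<open>a \<ge> 1\<close>.\<close>
  have c_neg: "c (- int s) = 0" for s
    using assms d(2) by (simp add: c_def)
  have c_pos: "c (int r) = 0" if "r > N" for r
    using that c_zero by simp
  have support: "t \<in> {int a..int N}" if "c t \<noteq> 0" for t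
    using that c_zero[of t] unfolding atLeastAtMost_iff by linarith
  then have "{t. c t \<noteq> 0} \<subseteq> {int a..int N}"
    by blast
  then have fin: "finite {t. c t \<noteq> 0}"
    by (rule finite_subset) simp
  have "of_int (n * fact a) = (\<Sum>r=1..N. of_int (c (int r)) * (-1) ^ (r + 1) * fact r :: rat)"
    unfolding n s c_nat by simp
  then have total: "of_int (n * fact a) = (\<Sum>s=1..N. of_int (c (- int s)) * ((-1) ^ s / fact (s + 1)))
      + (\<Sum>r=1..N. of_int (c (int r)) * (-1) ^ (r + 1) * fact r :: rat)"
    unfolding c_neg by (metis (no_types, lifting) add_0 mult_zero_left of_int_0 sum.neutral)
  have "is_expansion (of_int (n * fact a)) c"
  proof (rule is_expansion_iff[where K = N, THEN iffD2])
    show "c 0 = 0 \<and> finite {t. c t \<noteq> 0} \<and>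
      (\<forall>s::nat. s \<ge> 1 \<longrightarrow> 0 \<le> c (- int s) \<and> c (- int s) \<le> int s) \<and>
      (\<forall>r::nat. r \<ge> 1 \<longrightarrow> 0 \<le> c (int r) \<and> c (int r) \<le> int r) \<and>
      of_int (n * fact a) = (\<Sum>s=1..N. of_int (c (- int s)) * ((-1) ^ s / fact (s + 1)))
        + (\<Sum>r=1..N. of_int (c (int r)) * (-1) ^ (r + 1) * fact r :: rat)"
      using fin total d(1) c_neg[of 0] by (intro conjI) (auto simp: c_neg c_nat)
  qed (simp_all add: c_neg c_pos)
  from digit_eqI[OF this] show ?thesis
    unfolding rat_dom_def using support atLeastAtMost_iff by blast
qed

text \<open>Ensures that \<open>Min\<close> of the domain of \<open>\<gamma>\<close> is an actual
  element of it.\<close>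

lemma rat_dom_nonempty:
  assumes "q \<noteq> 0"
  shows "rat_dom q \<noteq> {}"
proof
  assume "rat_dom q = {}"
  then have "digit q t = 0" if "t \<noteq> 0" for t
    using that by (auto simp: rat_dom_def)
  then have "q = 0"
    using is_expansion_digit[of q] by (simp add: is_expansion_def)
  with assms show False by simp
qed

text \<open>An integral value would force all fractional digits to vanish, yet the digit at
  \<open>s\<close> is 1.\<close>

lemma signed_inverse_fact_notin_Ints:
  assumes "s \<ge> 1"
  shows "(-1) ^ s / fact (s + 1) \<notin> (\<int> :: rat set)"
proof
  assume "(-1) ^ s / fact (s + 1) \<in> (\<int> :: rat set)"
  moreover have "(\<Sum>r=1..s. of_int (if r = s then 1 else 0) * ((-1) ^ r / fact (r + 1)))
      = ((-1) ^ s / fact (s + 1) :: rat)"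
    using assms by (subst sum.remove[of _ s]) (auto intro!: sum.neutral simp del: fact_Suc)
  ultimately have "\<forall>r\<in>{1..s}. (if r = s then 1 else 0 :: int) = 0"
    by (intro frac_digits_unique) auto
  then show False
    using assms by force
qed

section \<open>Choice of the parameters and error estimate\<close>

theorem mainTheorem13:
  fixes \<delta> k1 k2 \<epsilon> :: real and k :: nat
  assumes "k \<ge> 1" and "k1 < k2" and "\<epsilon> > 0"
  shows "\<exists>(\<beta>::rat) (\<gamma>::int) (m :: int \<Rightarrow> int \<Rightarrow> int).
           \<beta> \<notin> \<int> \<and> \<gamma> \<noteq> 0 \<and>
           dom_pos \<beta> = {} \<and> dom_neg (of_int \<gamma>) = {} \<and>
           real_of_int (Max (dom_neg \<beta>)) < k1 \<and>
           k2 < real_of_int (Min (dom_pos (of_int \<gamma>))) \<and>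
           (\<forall>p q. 0 \<le> p \<and> p \<le> int k \<and> 0 \<le> q \<and> q \<le> int k \<longrightarrow>
              \<bar>\<delta> * (of_int p * of_rat \<beta> + of_int q * of_int \<gamma>)\<^sup>2 - of_int (m p q)\<bar> < \<epsilon>)"
proof -
  define a where "a = Suc (nat \<lceil>\<bar>k2\<bar>\<rceil>)"
  have a: "a \<ge> 1" "k2 < real a"
    by (simp_all add: a_def) linarith
  \<comment> \<open>Scaling by \<open>q\<^sup>2 \<le> k\<^sup>2\<close> turns this tolerance into at
    most \<open>\<epsilon> / 2\<close>; the other half is left for the terms with
    \<open>\<beta>\<close>.\<close>
  define \<epsilon>' where "\<epsilon>' = \<epsilon> / (2 * (real k)\<^sup>2)"
  have k: "(real k)\<^sup>2 > 0"
    using assms(1) by simp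
  then have "\<epsilon>' > 0"
    using assms(3) by (simp add: \<epsilon>'_def)
  from square_multiple_near_int[OF this, of "\<delta> * (fact a)\<^sup>2"] obtain n m0 :: int where n: "n > 0"
    and m0: "\<bar>\<delta> * (fact a)\<^sup>2 * (of_int n)\<^sup>2 - of_int m0\<bar> < \<epsilon>'"
    by blast
  define \<gamma> where "\<gamma> = n * fact a"
  have \<gamma>: "\<gamma> \<noteq> 0" "\<bar>\<delta> * (of_int \<gamma>)\<^sup>2 - of_int m0\<bar> < \<epsilon>'"
    using n m0 by (simp_all add: \<gamma>_def power_mult_distrib mult_ac)
  \<comment> \<open>Bounds \<open>\<bar>\<delta> * (p\<^sup>2 * b + 2 * p * q *
    \<gamma>)\<bar>\<close> whenever \<open>\<bar>b\<bar> \<le> 1\<close>; the added 1 keeps it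
    positive even for \<open>\<delta> = 0\<close>.\<close>
  define B where "B = \<bar>\<delta>\<bar> * (real k)\<^sup>2 * (1 + 2 * \<bar>of_int \<gamma>\<bar>) + 1"
  have B: "B > 0"
    by (simp add: B_def add_nonneg_pos)
  \<comment> \<open>The first bound makes \<open>\<bar>b\<bar> * B < \<epsilon> / 2\<close>, since
    \<open>\<bar>b\<bar> \<le> 1 / s\<close>; the second puts \<open>- s\<close> below
    \<open>k1\<close>.\<close>
  obtain s :: nat where s: "max (2 * B / \<epsilon>) \<bar>k1\<bar> < real s"
    using reals_Archimedean2 by blast
  then have s1: "s \<ge> 1"
    by linarith
  define \<beta> :: rat where "\<beta> = (-1) ^ s / fact (s + 1)"
  define b :: real where "b = of_rat \<beta>"
  have b_eq: "\<bar>b\<bar> = 1 / fact (s + 1)"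
  proof -
    have "of_rat (fact (s + 1)) = (fact (s + 1) :: real)"
      by (metis of_nat_fact of_rat_of_nat_eq)
    then show ?thesis
      by (simp add: b_def \<beta>_def of_rat_divide of_rat_power of_rat_minus power_abs del: fact_Suc)
  qed
  have b1: "\<bar>b\<bar> \<le> 1"
    unfolding b_eq by (simp add: fact_ge_1 del: fact_Suc)
  have "real s \<le> fact (s + 1)"
    using fact_ge_self[of "s + 1"] by (metis add_leD1 of_nat_fact of_nat_mono)
  moreover have "real s > 0"
    using s1 by simp
  ultimately have "\<bar>b\<bar> \<le> 1 / real s"
    unfolding b_eq by (intro divide_left_mono) auto
  then have "\<bar>b\<bar> * B \<le> 1 / real s * B"
    using B by (intro mult_right_mono) auto
  also have "\<dots> < \<epsilon> / 2"
    using s s1 assms(3) by (simp add: field_simps)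
  finally have bB: "\<bar>b\<bar> * B < \<epsilon> / 2" .
  \<comment> \<open>The integer \<open>q\<^sup>2 * m0\<close> is independent of \<open>p\<close>, as
    every term with \<open>p\<close> carries a factor \<open>b\<close>.\<close>
  have error: "\<bar>\<delta> * (of_int p * b + of_int q * of_int \<gamma>)\<^sup>2 - of_int (q\<^sup>2 * m0)\<bar> < \<epsilon>"
    if pq: "0 \<le> p" "p \<le> int k" "0 \<le> q" "q \<le> int k" for p q
  proof -
    define P Q G where "P = real_of_int p" and "Q = real_of_int q" and "G = real_of_int \<gamma>"
    have PQ: "0 \<le> P" "P \<le> real k" "0 \<le> Q" "Q \<le> real k"
      using pq unfolding P_def Q_def by linarith+
    then have bounds: "P\<^sup>2 \<le> (real k)\<^sup>2" "Q\<^sup>2 \<le> (real k)\<^sup>2" "P * Q \<le> (real k)\<^sup>2"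
      by (auto intro: power_mono mult_mono simp: power2_eq_square)
    have "\<delta> * (P * b + Q * G)\<^sup>2 - Q\<^sup>2 * of_int m0
        = Q\<^sup>2 * (\<delta> * G\<^sup>2 - of_int m0) + \<delta> * b * (P\<^sup>2 * b + 2 * (P * Q) * G)"
      by (simp add: power2_eq_square algebra_simps)
    also have "\<bar>\<dots>\<bar> \<le> \<bar>Q\<^sup>2 * (\<delta> * G\<^sup>2 - of_int m0)\<bar> + \<bar>\<delta> * b * (P\<^sup>2 * b + 2 * (P * Q) * G)\<bar>"
      by (rule abs_triangle_ineq)
    also have "\<bar>Q\<^sup>2 * (\<delta> * G\<^sup>2 - of_int m0)\<bar> \<le> (real k)\<^sup>2 * \<epsilon>'"
      using bounds \<gamma>(2) unfolding abs_mult G_def by (intro mult_mono) auto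
    also have "(real k)\<^sup>2 * \<epsilon>' = \<epsilon> / 2"
      using k by (simp add: \<epsilon>'_def)
    also have "\<bar>\<delta> * b * (P\<^sup>2 * b + 2 * (P * Q) * G)\<bar> \<le> \<bar>b\<bar> * B"
    proof -
      have "\<bar>P\<^sup>2 * b + 2 * (P * Q) * G\<bar> \<le> \<bar>P\<^sup>2 * b\<bar> + \<bar>2 * (P * Q) * G\<bar>"
        by (rule abs_triangle_ineq)
      also have "\<bar>P\<^sup>2 * b\<bar> \<le> (real k)\<^sup>2 * 1"
        using bounds b1 unfolding abs_mult by (intro mult_mono) auto
      also have "\<bar>2 * (P * Q) * G\<bar> \<le> 2 * (real k)\<^sup>2 * \<bar>G\<bar>"
        using bounds PQ unfolding abs_mult by (intro mult_mono) auto
      also have "(real k)\<^sup>2 * 1 + 2 * (real k)\<^sup>2 * \<bar>G\<bar> = (real k)\<^sup>2 * (1 + 2 * \<bar>G\<bar>)"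
        by (simp add: algebra_simps)
      finally have "\<bar>\<delta>\<bar> * \<bar>P\<^sup>2 * b + 2 * (P * Q) * G\<bar> \<le> \<bar>\<delta>\<bar> * ((real k)\<^sup>2 * (1 + 2 * \<bar>G\<bar>))"
        by (intro mult_left_mono) auto
      then have "\<bar>\<delta>\<bar> * \<bar>P\<^sup>2 * b + 2 * (P * Q) * G\<bar> \<le> B"
        by (simp add: B_def G_def mult.assoc)
      then have "\<bar>b\<bar> * (\<bar>\<delta>\<bar> * \<bar>P\<^sup>2 * b + 2 * (P * Q) * G\<bar>) \<le> \<bar>b\<bar> * B"
        by (intro mult_left_mono) auto
      then show ?thesis
        by (simp add: abs_mult mult_ac)
    qed
    finally show ?thesis
      using bB by (simp add: P_def Q_def G_def)
  qed
  have dom_\<beta>: "rat_dom \<beta> = {- int s}"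
    unfolding \<beta>_def by (rule rat_dom_signed_inverse_fact[OF s1])
  have dom_\<gamma>: "rat_dom (of_int \<gamma>) \<subseteq> {int a..}"
    unfolding \<gamma>_def by (rule rat_dom_int_multiple_fact[OF a(1)])
  then have dom_pos_\<gamma>: "dom_pos (of_int \<gamma>) = rat_dom (of_int \<gamma>)"
    using a(1) by (force simp: dom_pos_def)
  have "Min (dom_pos (of_int \<gamma>)) \<in> {int a..}"
    using dom_\<gamma> Min_in[OF finite_rat_dom[of "of_int \<gamma>"]] rat_dom_nonempty[of "of_int \<gamma>"] \<gamma>(1)
    unfolding dom_pos_\<gamma> by auto
  then have "k2 < real_of_int (Min (dom_pos (of_int \<gamma>)))"
    using a(2) by simp
  moreover have "dom_neg (of_int \<gamma>) = {}"
    using dom_\<gamma> a(1) by (force simp: dom_neg_def)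
  moreover have "dom_neg \<beta> = {- int s}" "dom_pos \<beta> = {}"
    using s1 by (auto simp: dom_neg_def dom_pos_def dom_\<beta>)
  moreover have "- real s < k1"
    using s by linarith
  moreover have "\<beta> \<notin> \<int>"
    unfolding \<beta>_def by (rule signed_inverse_fact_notin_Ints[OF s1])
  ultimately show ?thesis
    using \<gamma>(1) error
    by (intro exI[of _ \<beta>] exI[of _ \<gamma>] exI[of _ "\<lambda>p q. q\<^sup>2 * m0"]) (simp add: b_def)
qed

end
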